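(* Let $\mathbf M$ be an $\mathcal L$-structure with the $\mathrm{VC}d$ property. Then every finite nonempty set $\Delta(x;y)$ of partitioned $\mathcal L$-formulas has a uniform definition of $\Delta(x;B)$-types over finite sets in $\mathbf M$ with $d|x|$ parameters.
   Context: For a finite set $\Delta(x;y)$ of partitioned $\mathcal L$-formulas and finite $B\subseteq M^{|y|}$, $S^\Delta(B)$ is the set of types $\mathrm{tp}^\Delta(a/B)=\{\varphi(x;b):\varphi\in\Delta,b\in B,\mathbf M\models\varphi(a;b)\}\cup\{\neg\varphi(x;b):\varphi\in\Delta,b\in B,\mathbf M\not\models\varphi(a;b)\}$, $a\in M^{|x|}$. A uniform definition of $\Delta(x;B)$-types over finite sets in $\mathbf M$ with $d$ parameters is a finite family $(\mathcal F_i)_{i\in I}$ with $\mathcal F_i=(\varphi_i(y;y_1,\dots,y_d))_{\varphi\in\Delta}$ $\mathcal L$-formulas, $|y_j|=|y|$, such that for every finite $B\subseteq M^{|y|}$ and every $q\in S^\Delta(B)$ there are $b_1,\dots,b_d\in B$ and $i\in I$ with: for all $\varphi\in\Delta$ and $b\in B$, $\varphi(x;b)\in q$ iff $\mathbf M\models\varphi_i(b;b_1,\dots,b_d)$. $\mathbf M$ has the $\mathrm{VC}d$ property if every finite nonempty $\Delta(x;y)$ with $|x|=1$ has such a uniform definition with $d$ parameters. *)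

theory Defs
  imports Main
begin

record ('f, 'r) language =
  funs :: "'f set"
  rels :: "'r set"
  farity :: "'f \<Rightarrow> nat"
  rarity :: "'r \<Rightarrow> nat"

datatype 'f tm = Var nat | App 'f "'f tm list"

datatype ('f, 'r) fm =
    Eq "'f tm" "'f tm"
  | Rel 'r "'f tm list"
  | Neg "('f, 'r) fm"
  | Conj "('f, 'r) fm" "('f, 'r) fm"
  | Ex nat "('f, 'r) fm"

fun tm_of :: "('f, 'r) language \<Rightarrow> 'f tm \<Rightarrow> bool" where
  "tm_of L (Var v) \<longleftrightarrow> True"
| "tm_of L (App f ts) \<longleftrightarrow> f \<in> funs L \<and> length ts = farity L f \<and> (\<forall>t\<in>set ts. tm_of L t)"

fun fm_of :: "('f, 'r) language \<Rightarrow> ('f, 'r) fm \<Rightarrow> bool" where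
  "fm_of L (Eq s t) \<longleftrightarrow> tm_of L s \<and> tm_of L t"
| "fm_of L (Rel r ts) \<longleftrightarrow> r \<in> rels L \<and> length ts = rarity L r \<and> (\<forall>t\<in>set ts. tm_of L t)"
| "fm_of L (Neg \<phi>) \<longleftrightarrow> fm_of L \<phi>"
| "fm_of L (Conj \<phi> \<psi>) \<longleftrightarrow> fm_of L \<phi> \<and> fm_of L \<psi>"
| "fm_of L (Ex v \<phi>) \<longleftrightarrow> fm_of L \<phi>"

fun tvars :: "'f tm \<Rightarrow> nat set" where
  "tvars (Var v) = {v}"
| "tvars (App f ts) = (\<Union>t\<in>set ts. tvars t)"

fun fvars :: "('f, 'r) fm \<Rightarrow> nat set" where
  "fvars (Eq s t) = tvars s \<union> tvars t"
| "fvars (Rel r ts) = (\<Union>t\<in>set ts. tvars t)"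
| "fvars (Neg \<phi>) = fvars \<phi>"
| "fvars (Conj \<phi> \<psi>) = fvars \<phi> \<union> fvars \<psi>"
| "fvars (Ex v \<phi>) = fvars \<phi> - {v}"

record ('a, 'f, 'r) struct =
  univ :: "'a set"
  fint :: "'f \<Rightarrow> 'a list \<Rightarrow> 'a"
  rint :: "'r \<Rightarrow> 'a list set"

definition tuples :: "'a set \<Rightarrow> nat \<Rightarrow> 'a list set" where
  "tuples A n = {as. length as = n \<and> set as \<subseteq> A}"

definition is_structure :: "('f, 'r) language \<Rightarrow> ('a, 'f, 'r) struct \<Rightarrow> bool" where
  "is_structure L M \<longleftrightarrow>
     univ M \<noteq> {} \<and>
     (\<forall>f\<in>funs L. \<forall>as\<in>tuples (univ M) (farity L f). fint M f as \<in> univ M) \<and>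
     (\<forall>r\<in>rels L. rint M r \<subseteq> tuples (univ M) (rarity L r))"

fun teval :: "('a, 'f, 'r) struct \<Rightarrow> (nat \<Rightarrow> 'a) \<Rightarrow> 'f tm \<Rightarrow> 'a" where
  "teval M e (Var v) = e v"
| "teval M e (App f ts) = fint M f (map (teval M e) ts)"

fun sat :: "('a, 'f, 'r) struct \<Rightarrow> (nat \<Rightarrow> 'a) \<Rightarrow> ('f, 'r) fm \<Rightarrow> bool" where
  "sat M e (Eq s t) \<longleftrightarrow> teval M e s = teval M e t"
| "sat M e (Rel r ts) \<longleftrightarrow> map (teval M e) ts \<in> rint M r"
| "sat M e (Neg \<phi>) \<longleftrightarrow> \<not> sat M e \<phi>"
| "sat M e (Conj \<phi> \<psi>) \<longleftrightarrow> sat M e \<phi> \<and> sat M e \<psi>"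
| "sat M e (Ex v \<phi>) \<longleftrightarrow> (\<exists>a\<in>univ M. sat M (e(v := a)) \<phi>)"

text \<open>\<open>holds M \<phi> vs as\<close> is satisfaction of \<open>\<phi>(as)\<close> where \<open>as\<close> is substituted for the variable tuple
  \<open>vs\<close>. It is used only for distinct \<open>vs\<close> containing all free variables of \<open>\<phi>\<close>, so that the value
  \<open>undefined\<close> given to the other variables is never consulted.\<close>

definition assign :: "nat list \<Rightarrow> 'a list \<Rightarrow> nat \<Rightarrow> 'a" where
  "assign vs as v = (case map_of (zip vs as) v of Some a \<Rightarrow> a | None \<Rightarrow> undefined)"

definition holds :: "('a, 'f, 'r) struct \<Rightarrow> ('f, 'r) fm \<Rightarrow> nat list \<Rightarrow> 'a list \<Rightarrow> bool" where
  "holds M \<phi> vs as \<longleftrightarrow> sat M (assign vs as) \<phi>"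

definition partitioned_fms ::
  "('f, 'r) language \<Rightarrow> ('f, 'r) fm set \<Rightarrow> nat list \<Rightarrow> nat list \<Rightarrow> bool" where
  "partitioned_fms L \<Delta> x y \<longleftrightarrow>
     distinct (x @ y) \<and> (\<forall>\<phi>\<in>\<Delta>. fm_of L \<phi> \<and> fvars \<phi> \<subseteq> set x \<union> set y)"

text \<open>An instance \<open>\<phi>(x;b)\<close> is represented by the pair \<open>(\<phi>, b)\<close>; in particular \<open>\<not>\<phi>(x;b)\<close> is
  \<open>(Neg \<phi>, b)\<close>.\<close>

definition tp ::
  "('a, 'f, 'r) struct \<Rightarrow> ('f, 'r) fm set \<Rightarrow> nat list \<Rightarrow> nat list \<Rightarrow> 'a list \<Rightarrow> 'a list set
     \<Rightarrow> (('f, 'r) fm \<times> 'a list) set" where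
  "tp M \<Delta> x y a B =
     {(\<phi>, b) |\<phi> b. \<phi> \<in> \<Delta> \<and> b \<in> B \<and> holds M \<phi> (x @ y) (a @ b)} \<union>
     {(Neg \<phi>, b) |\<phi> b. \<phi> \<in> \<Delta> \<and> b \<in> B \<and> \<not> holds M \<phi> (x @ y) (a @ b)}"

definition types ::
  "('a, 'f, 'r) struct \<Rightarrow> ('f, 'r) fm set \<Rightarrow> nat list \<Rightarrow> nat list \<Rightarrow> 'a list set
     \<Rightarrow> (('f, 'r) fm \<times> 'a list) set set" where
  "types M \<Delta> x y B = {tp M \<Delta> x y a B |a. a \<in> tuples (univ M) (length x)}"

text \<open>\<open>F i \<phi>\<close> is the formula \<open>\<phi>\<^sub>i(y; y\<^sub>1, \<dots>, y\<^sub>d)\<close> and \<open>ys\<close> is the list of variable tuples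
  \<open>y\<^sub>1, \<dots>, y\<^sub>d\<close>. The sets \<open>B\<close> are taken nonempty: over the empty set there is a type but no
  parameter can be chosen, so that for \<open>d > 0\<close> no uniform definition would exist at all.\<close>

definition uniform_def ::
  "('f, 'r) language \<Rightarrow> ('a, 'f, 'r) struct \<Rightarrow> ('f, 'r) fm set \<Rightarrow> nat list \<Rightarrow> nat list \<Rightarrow> nat
     \<Rightarrow> nat list list \<Rightarrow> nat set \<Rightarrow> (nat \<Rightarrow> ('f, 'r) fm \<Rightarrow> ('f, 'r) fm) \<Rightarrow> bool" where
  "uniform_def L M \<Delta> x y d ys I F \<longleftrightarrow>
     length ys = d \<and> (\<forall>v\<in>set ys. length v = length y) \<and> distinct (y @ concat ys) \<and>
     finite I \<and>
     (\<forall>i\<in>I. \<forall>\<phi>\<in>\<Delta>. fm_of L (F i \<phi>) \<and> fvars (F i \<phi>) \<subseteq> set y \<union> set (concat ys)) \<and>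
     (\<forall>B. finite B \<longrightarrow> B \<noteq> {} \<longrightarrow> B \<subseteq> tuples (univ M) (length y) \<longrightarrow>
        (\<forall>q\<in>types M \<Delta> x y B. \<exists>bs i. length bs = d \<and> set bs \<subseteq> B \<and> i \<in> I \<and>
           (\<forall>\<phi>\<in>\<Delta>. \<forall>b\<in>B. (\<phi>, b) \<in> q \<longleftrightarrow>
              holds M (F i \<phi>) (y @ concat ys) (b @ concat bs))))"

definition has_uniform_def ::
  "('f, 'r) language \<Rightarrow> ('a, 'f, 'r) struct \<Rightarrow> ('f, 'r) fm set \<Rightarrow> nat list \<Rightarrow> nat list \<Rightarrow> nat
     \<Rightarrow> bool" where
  "has_uniform_def L M \<Delta> x y d \<longleftrightarrow> (\<exists>ys I F. uniform_def L M \<Delta> x y d ys I F)"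

definition VC_property :: "('f, 'r) language \<Rightarrow> ('a, 'f, 'r) struct \<Rightarrow> nat \<Rightarrow> bool" where
  "VC_property L M d \<longleftrightarrow>
     (\<forall>\<Delta> x y. finite \<Delta> \<longrightarrow> \<Delta> \<noteq> {} \<longrightarrow> partitioned_fms L \<Delta> x y \<longrightarrow> length x = 1 \<longrightarrow>
        has_uniform_def L M \<Delta> x y d)"

end

theory Submission
  imports Defs "HOL-Library.Nat_Bijection"
begin

text \<open>Induction on the length of \<open>x\<close>. Write \<open>x = (v, x')\<close> and \<open>a = (a\<^sub>0, a')\<close>. The VC property,
  applied to \<open>\<Delta>(v; x', y)\<close>, defines the type of \<open>a\<^sub>0\<close> over \<open>{a'} \<times> B\<close> by a formula whose parameters
  are \<open>(a', b\<^sub>1), \<dots>, (a', b\<^sub>d)\<close>. Identifying all the copies of \<open>x'\<close> gives formulas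
  \<open>\<psi>(x'; y, y\<^sub>1, \<dots>, y\<^sub>d)\<close>, and the induction hypothesis defines the type of \<open>a'\<close> in these formulas
  over \<open>B \<times> {(b\<^sub>1, \<dots>, b\<^sub>d)}\<close>. Its parameters are \<open>(c\<^sub>j, b\<^sub>1, \<dots>, b\<^sub>d)\<close>, so identifying again the
  repeated variables leaves \<open>b\<^sub>1, \<dots>, b\<^sub>d\<close> and the \<open>d |x'|\<close> tuples \<open>c\<^sub>j\<close>.\<close>

section \<open>Assignments and dependence on free variables\<close>

lemma teval_cong: "(\<And>v. v \<in> tvars t \<Longrightarrow> e v = e' v) \<Longrightarrow> teval M e t = teval M e' t"
proof (induction t)
  case (App f ts)
  then have "map (teval M e) ts = map (teval M e') ts" by auto
  then show ?case by (simp del: map_eq_conv)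
qed simp

lemma sat_cong: "(\<And>v. v \<in> fvars \<phi> \<Longrightarrow> e v = e' v) \<Longrightarrow> sat M e \<phi> = sat M e' \<phi>"
proof (induction \<phi> arbitrary: e e')
  case (Eq s t)
  then have "teval M e s = teval M e' s" "teval M e t = teval M e' t"
    by (auto intro!: teval_cong)
  then show ?case by simp
next
  case (Rel r ts)
  then have "map (teval M e) ts = map (teval M e') ts"
    by (auto intro!: teval_cong)
  then show ?case by (simp del: map_eq_conv)
next
  case (Neg \<phi>)
  have "sat M e \<phi> = sat M e' \<phi>"
    by (rule Neg.IH) (use Neg.prems in auto)
  then show ?case by simp
next
  case (Conj \<phi> \<psi>)
  have "sat M e \<phi> = sat M e' \<phi>"
    by (rule Conj.IH(1)) (use Conj.prems in auto)
  moreover have "sat M e \<psi> = sat M e' \<psi>"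
    by (rule Conj.IH(2)) (use Conj.prems in auto)
  ultimately show ?case by simp
next
  case (Ex v \<phi>)
  have "sat M (e(v := a)) \<phi> = sat M (e'(v := a)) \<phi>" for a
    by (rule Ex.IH) (use Ex.prems in auto)
  then show ?case by simp
qed

lemma map_assign:
  assumes "distinct vs" "length as = length vs"
  shows "map (assign vs as) vs = as"
  using assms
  by (auto simp: assign_def list_eq_iff_nth_eq map_of_zip_nth)

lemma assign_map_eq:
  assumes "distinct vs" "v \<in> set vs"
  shows "assign vs (map e vs) v = e v"
  using map_assign[OF assms(1), of "map e vs"] assms(2) by simp

section \<open>Identifying variables inside a formula\<close>

text \<open>Substitution of \<open>r u\<close> for the variables \<open>u\<close> in \<open>us\<close> for an idempotent \<open>r\<close>. Quantifying
  over the replaced variables makes it unnecessary to rename bound ones.\<close>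

fun identify :: "(nat \<Rightarrow> nat) \<Rightarrow> nat list \<Rightarrow> ('f, 'r) fm \<Rightarrow> ('f, 'r) fm" where
  "identify r [] \<phi> = \<phi>"
| "identify r (u # us) \<phi> =
     (if r u = u then identify r us \<phi>
      else Ex u (Conj (Eq (Var u) (Var (r u))) (identify r us \<phi>)))"

lemma fm_of_identify: "fm_of L (identify r us \<phi>) = fm_of L \<phi>"
  by (induction us) auto

text \<open>A replaced variable gets bound and only its representative \<open>r u\<close> enters; a
  variable fixed by \<open>r\<close> is its own representative.\<close>

lemma fvars_identify: "fvars (identify r us \<phi>) \<subseteq> r ` set us \<union> (fvars \<phi> - set us)"
proof (induction us)
  case (Cons u us)
  then show ?case
  proof (cases "r u = u")
    case True
    then have "u \<in> r ` set (u # us)" by force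
    with Cons True show ?thesis by auto
  qed auto
qed simp

text \<open>The only possible witness for the quantified \<open>u\<close> is the value of
  \<open>r u\<close>, so that value has to lie in \<open>univ M\<close>. Idempotence makes every
  representative a fixed point of \<open>r\<close>, so no representative is ever
  overwritten.\<close>

lemma sat_identify:
  assumes "\<And>u. u \<in> set us \<Longrightarrow> r (r u) = r u \<and> e (r u) \<in> univ M"
  shows "sat M e (identify r us \<phi>) = sat M (\<lambda>v. if v \<in> set us then e (r v) else e v) \<phi>"
  using assms
proof (induction us arbitrary: e)
  case (Cons u us)
  show ?case
  proof (cases "r u = u")
    case True
    have "(\<lambda>v. if v \<in> set us then e (r v) else e v)
        = (\<lambda>v. if v \<in> set (u # us) then e (r v) else e v)"
      using True by auto
    with Cons True show ?thesis by simp
  next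
    case False
    let ?e = "e(u := e (r u))"
    \<comment> \<open>Otherwise \<open>u\<close> would be a value of \<open>r\<close> and hence
      fixed by \<open>r\<close>.\<close>
    have ne: "r w \<noteq> u" if "w \<in> set (u # us)" for w
      using Cons.prems[OF that] False by auto
    have "sat M e (identify r (u # us) \<phi>) = sat M ?e (identify r us \<phi>)"
      using False Cons.prems[of u] by auto
    also have "\<dots> = sat M (\<lambda>v. if v \<in> set us then ?e (r v) else ?e v) \<phi>"
      by (rule Cons.IH) (use Cons.prems ne in auto)
    also have "(\<lambda>v. if v \<in> set us then ?e (r v) else ?e v)
        = (\<lambda>v. if v \<in> set (u # us) then e (r v) else e v)"
      using ne by (auto simp: fun_eq_iff)
    finally show ?thesis .
  qed
qed simp

text \<open>Values in \<open>as\<close> may repeat where variables are identified. This trades a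
  parameter list with forced repetitions for the shorter list \<open>cs\<close>.\<close>

lemma holds_identify:
  assumes "distinct us" "fvars \<phi> \<subseteq> set us"
    and "\<And>u. u \<in> set us \<Longrightarrow> r (r u) = r u"
    and "map (assign ws cs) (map r us) = as" "set as \<subseteq> univ M"
  shows "holds M (identify r us \<phi>) ws cs = holds M \<phi> us as"
proof -
  let ?e = "assign ws cs"
  have "?e (r u) \<in> univ M" if "u \<in> set us" for u
    using assms(4,5) that by auto
  then have "sat M ?e (identify r us \<phi>)
      = sat M (\<lambda>v. if v \<in> set us then ?e (r v) else ?e v) \<phi>"
    using assms(3) by (intro sat_identify) auto
  also have "\<dots> = sat M (assign us as) \<phi>"
  proof (rule sat_cong)
    fix v assume "v \<in> fvars \<phi>"
    then have "v \<in> set us" using assms(2) by auto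
    moreover have "as = map (\<lambda>u. ?e (r u)) us" using assms(4) by auto
    ultimately show "(if v \<in> set us then ?e (r v) else ?e v) = assign us as v"
      using assign_map_eq[OF assms(1), of v "\<lambda>u. ?e (r u)"] by simp
  qed
  finally show ?thesis by (simp add: holds_def)
qed

section \<open>Blocks of variables and of parameters\<close>

text \<open>The blocks are disjoint, so \<open>r\<close> can be prescribed on each one
  independently; \<open>assign z (g z)\<close> serves as the finite map that sends \<open>z\<close>
  to \<open>g z\<close>.\<close>

lemma ex_blockwise_map:
  fixes zs :: "nat list list"
  assumes "distinct (concat zs)" "\<And>z. z \<in> set zs \<Longrightarrow> length (g z) = length z"
  shows "\<exists>r. (\<forall>z\<in>set zs. map r z = g z) \<and> (\<forall>u. u \<notin> set (concat zs) \<longrightarrow> r u = u)"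
  using assms
proof (induction zs)
  case Nil
  show ?case by (rule exI[of _ "\<lambda>u. u"]) simp
next
  case (Cons z zs)
  then obtain r where r: "\<And>w. w \<in> set zs \<Longrightarrow> map r w = g w"
    "\<And>u. u \<notin> set (concat zs) \<Longrightarrow> r u = u"
    by (metis concat.simps(2) distinct_append list.set_intros(2))
  define r' where "r' u = (if u \<in> set z then assign z (g z) u else r u)" for u
  have "map r' z = map (assign z (g z)) z"
    by (simp add: r'_def)
  also have "\<dots> = g z"
    using Cons.prems by (intro map_assign) auto
  finally have "map r' z = g z" .
  moreover have "map r' w = g w" if "w \<in> set zs" for w
  proof -
    have "map r' w = map r w"
      using Cons.prems(1) that by (auto simp: r'_def)
    then show ?thesis using r(1)[OF that] by simp
  qed
  ultimately show ?case
    using r(2) by (intro exI[of _ r'] conjI) (simp, simp add: r'_def)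
qed

lemma distinct_concat_map_sub:
  assumes "distinct (concat zs)"
    and "\<And>z. distinct z \<Longrightarrow> distinct (f z)" "\<And>z. set (f z) \<subseteq> set z"
  shows "distinct (concat (map f zs))"
  using assms(1)
proof (induction zs)
  case (Cons z zs)
  have "set (concat (map f zs)) \<subseteq> set (concat zs)"
    using assms(3) by fastforce
  then show ?case using Cons assms(2)[of z] assms(3)[of z] by auto
qed simp

lemma length_concat_uniform:
  assumes "\<And>z. z \<in> set zs \<Longrightarrow> length z = n"
  shows "length (concat zs) = length zs * n"
  using assms by (induction zs) auto

text \<open>Assignments see only flat variable lists; equal block lengths allow the separate
  parameter tuples to be recovered.\<close>

lemma map_map_eq_if_concat:
  assumes "map e (concat zs) = concat bs" "length bs = length zs"
    and "\<And>z. z \<in> set zs \<Longrightarrow> length z = n" "\<And>b. b \<in> set bs \<Longrightarrow> length b = n"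
  shows "map (map e) zs = bs"
proof (rule concat_injective)
  show "concat (map (map e) zs) = concat bs" using assms(1) by (simp add: map_concat)
  show "\<forall>(p, q)\<in>set (zip (map (map e) zs) bs). length p = length q"
    using assms(3,4) by (fastforce dest: set_zip_leftD set_zip_rightD)
qed (use assms(2) in simp)

section \<open>Types and their realizations\<close>

text \<open>If \<open>\<phi>\<close> is \<open>Neg \<psi>\<close> with \<open>\<psi>\<close> in
  \<open>\<Delta>\<close>, the pair may also enter through the negative half of the type; the
  semantics of \<open>Neg\<close> makes both readings agree.\<close>

lemma tp_iff:
  assumes "\<phi> \<in> \<Delta>" "b \<in> B"
  shows "(\<phi>, b) \<in> tp M \<Delta> x y a B \<longleftrightarrow> holds M \<phi> (x @ y) (a @ b)"
  using assms by (auto simp: tp_def holds_def)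

lemma uniform_def_realize:
  assumes "uniform_def L M \<Delta> x y d ys I F"
    and "finite B" "B \<noteq> {}" "B \<subseteq> tuples (univ M) (length y)" "a \<in> tuples (univ M) (length x)"
  obtains bs i where "length bs = d" "set bs \<subseteq> B" "i \<in> I"
    "\<And>\<phi> b. \<phi> \<in> \<Delta> \<Longrightarrow> b \<in> B \<Longrightarrow>
       holds M \<phi> (x @ y) (a @ b) \<longleftrightarrow> holds M (F i \<phi>) (y @ concat ys) (b @ concat bs)"
proof -
  have "tp M \<Delta> x y a B \<in> types M \<Delta> x y B"
    using assms(5) by (auto simp: types_def)
  then obtain bs i where "length bs = d" "set bs \<subseteq> B" "i \<in> I"
    "\<forall>\<phi>\<in>\<Delta>. \<forall>b\<in>B. (\<phi>, b) \<in> tp M \<Delta> x y a B \<longleftrightarrow>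
       holds M (F i \<phi>) (y @ concat ys) (b @ concat bs)"
    using assms unfolding uniform_def_def by meson
  then show ?thesis using that by (simp add: tp_iff)
qed

text \<open>A point of the universe gives a one-element \<open>B\<close> and a type over it, which
  some index must define. This keeps the family handed to the induction hypothesis nonempty.\<close>

lemma uniform_def_index_nonempty:
  assumes "is_structure L M" "uniform_def L M \<Delta> x y d ys I F"
  shows "I \<noteq> {}"
proof -
  obtain a where a: "a \<in> univ M" using assms(1) by (auto simp: is_structure_def)
  have "replicate n a \<in> tuples (univ M) n" for n
    using a by (auto simp: tuples_def)
  then show ?thesis
    using uniform_def_realize[OF assms(2), of "{replicate (length y) a}" "replicate (length x) a"]
    by (metis empty_iff empty_subsetI finite.emptyI finite.insertI insert_not_empty insert_subset)
qed

text \<open>Traces parameters found in an image of \<open>B\<close> back to elements of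
  \<open>B\<close>.\<close>

lemma list_over_image:
  assumes "set bs \<subseteq> f ` B"
  obtains cs where "bs = map f cs" "set cs \<subseteq> B"
proof -
  have "bs \<in> lists (f ` B)" using assms by (auto simp: lists_eq_set)
  then have "bs \<in> map f ` lists B" by (simp only: lists_image)
  then show ?thesis using that by (auto simp: lists_eq_set)
qed

section \<open>The empty tuple of variables\<close>

text \<open>The empty tuple is the only realization, so every formula defines its own part of the
  type.\<close>

lemma has_uniform_def_Nil:
  assumes "partitioned_fms L \<Delta> [] y"
  shows "has_uniform_def L M \<Delta> [] y 0"
proof -
  have "uniform_def L M \<Delta> [] y 0 [] {0} (\<lambda>_ \<phi>. \<phi>)"
    using assms by (auto simp: uniform_def_def partitioned_fms_def types_def tuples_def tp_iff)
  then show ?thesis unfolding has_uniform_def_def by blast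
qed

section \<open>Adding one variable\<close>

text \<open>Each variable of a block either stays or moves into \<open>u\<close>, which
  \<open>r\<close> fixes; hence \<open>r\<close> is idempotent on these variables, as
  \<open>identify\<close> requires.\<close>

lemma ex_identifying_map:
  fixes u :: "nat list"
  assumes dist: "distinct (u @ concat zs)"
    and len: "\<And>z. z \<in> set zs \<Longrightarrow> length (g z) = length z"
    and g: "\<And>z i. z \<in> set zs \<Longrightarrow> i < length z \<Longrightarrow> g z ! i \<in> set u \<or> g z ! i = z ! i"
  obtains r where "map r (u @ concat zs) = u @ concat (map g zs)"
    "\<And>v. v \<in> set (u @ concat zs) \<Longrightarrow> r (r v) = r v"
proof -
  obtain r where r: "\<And>z. z \<in> set zs \<Longrightarrow> map r z = g z" "\<And>v. v \<notin> set (concat zs) \<Longrightarrow> r v = v"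
    using ex_blockwise_map[of zs g] dist len by auto
  have fix_u: "r v = v" if "v \<in> set u" for v
    using that dist by (intro r(2)) auto
  have "r (r v) = r v" if v: "v \<in> set (u @ concat zs)" for v
  proof (cases "v \<in> set u")
    case False
    then obtain z i where z: "z \<in> set zs" "i < length z" "v = z ! i"
      using v by (auto simp: in_set_conv_nth)
    then have "r v = g z ! i" using r(1)[OF z(1)] by (metis nth_map)
    with g[OF z(1,2)] fix_u z(3) show ?thesis by auto
  qed (simp add: fix_u)
  moreover have "map r (u @ concat zs) = u @ concat (map g zs)"
    using r(1) by (auto simp: map_concat fix_u map_idI intro!: arg_cong[of _ _ concat])
  ultimately show ?thesis using that by blast
qed

text \<open>\<open>rest\<close> ranges over all families and all \<open>y'\<close> because it is
  applied to new formulas, with \<open>y\<close> lengthened by \<open>d\<close> further copies of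
  itself.\<close>

lemma has_uniform_def_Cons:
  fixes L :: "('f, 'r) language" and M :: "('a, 'f, 'r) struct"
  assumes str: "is_structure L M"
    and fin: "finite \<Delta>" and ne: "\<Delta> \<noteq> {}"
    and first: "has_uniform_def L M \<Delta> [v] (x @ y) d"
    and rest: "\<And>\<Delta>' y'. finite \<Delta>' \<Longrightarrow> \<Delta>' \<noteq> {} \<Longrightarrow> partitioned_fms L \<Delta>' x y' \<Longrightarrow>
                 has_uniform_def L M \<Delta>' x y' d'"
  shows "has_uniform_def L M \<Delta> (v # x) y (d + d')"
proof -
  let ?m = "length x" and ?n = "length y"
  obtain ys I F where u1: "uniform_def L M \<Delta> [v] (x @ y) d ys I F"
    using first unfolding has_uniform_def_def by blast
  let ?U1 = "(x @ y) @ concat ys"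
  have ys: "length ys = d" "\<And>z. z \<in> set ys \<Longrightarrow> length z = ?m + ?n" "distinct ?U1" "finite I"
    and F: "\<And>i \<phi>. i \<in> I \<Longrightarrow> \<phi> \<in> \<Delta> \<Longrightarrow> fm_of L (F i \<phi>) \<and> fvars (F i \<phi>) \<subseteq> set ?U1"
    using u1 unfolding uniform_def_def set_append[of "_ @ _"] by simp_all
  \<comment> \<open>Each block of \<open>ys\<close> is a copy of \<open>x\<close> followed by a copy
    of \<open>y\<close>; only the latter is kept.\<close>
  define Ys where "Ys = map (drop ?m) ys"
  have Ys: "length Ys = d" "\<And>z. z \<in> set Ys \<Longrightarrow> length z = ?n" "set (concat Ys) \<subseteq> set (concat ys)"
    using ys by (auto simp: Ys_def dest: in_set_dropD)
  have distYs: "distinct (concat Ys)"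
    unfolding Ys_def using ys(3) by (intro distinct_concat_map_sub) (auto dest: in_set_dropD)
  have dist1: "distinct (x @ y @ concat Ys)"
    using ys(3) Ys(3) distYs by auto
  \<comment> \<open>\<open>r\<close> sends every copy of \<open>x\<close> to \<open>x\<close>
    itself, since all parameters will share the same tail \<open>a\<close>.\<close>
  obtain r where r: "map r ?U1 = (x @ y) @ concat (map (\<lambda>z. x @ drop ?m z) ys)"
    "\<And>u. u \<in> set ?U1 \<Longrightarrow> r (r u) = r u"
    by (rule ex_identifying_map[OF ys(3), of "\<lambda>z. x @ drop ?m z"])
      (auto simp: ys(2) nth_append)
  define \<psi> where "\<psi> i \<phi> = identify r ?U1 (F i \<phi>)" for i \<phi>
  let ?\<Delta>' = "(\<lambda>(i, \<phi>). \<psi> i \<phi>) ` (I \<times> \<Delta>)"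
  have \<psi>: "fm_of L (\<psi> i \<phi>)" "fvars (\<psi> i \<phi>) \<subseteq> set (x @ y @ concat Ys)"
    if "i \<in> I" "\<phi> \<in> \<Delta>" for i \<phi>
  proof -
    have "fvars (\<psi> i \<phi>) \<subseteq> r ` set ?U1"
      using fvars_identify[of r ?U1 "F i \<phi>"] F[OF that] unfolding \<psi>_def by blast
    also have "\<dots> = set (map r ?U1)" by (simp only: set_map)
    also have "\<dots> \<subseteq> set (x @ y @ concat Ys)" unfolding r(1) by (auto simp: Ys_def)
    finally show "fvars (\<psi> i \<phi>) \<subseteq> set (x @ y @ concat Ys)" .
    show "fm_of L (\<psi> i \<phi>)" using F[OF that] by (simp add: \<psi>_def fm_of_identify)
  qed
  have "I \<noteq> {}" using uniform_def_index_nonempty[OF str u1] .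
  then have "has_uniform_def L M ?\<Delta>' x (y @ concat Ys) d'"
    using fin ne ys(4) \<psi> dist1 by (intro rest) (auto simp: partitioned_fms_def)
  then obtain zs J G where u2: "uniform_def L M ?\<Delta>' x (y @ concat Ys) d' zs J G"
    unfolding has_uniform_def_def by blast
  let ?U2 = "(y @ concat Ys) @ concat zs"
  have zs: "length zs = d'" "\<And>z. z \<in> set zs \<Longrightarrow> length z = ?n + length (concat Ys)"
    "distinct ?U2" "finite J"
    and G: "\<And>j i \<phi>. j \<in> J \<Longrightarrow> i \<in> I \<Longrightarrow> \<phi> \<in> \<Delta> \<Longrightarrow>
      fm_of L (G j (\<psi> i \<phi>)) \<and> fvars (G j (\<psi> i \<phi>)) \<subseteq> set ?U2"
    using u2 unfolding uniform_def_def set_append[of "_ @ _"] by force+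
  \<comment> \<open>Each block of \<open>zs\<close> is a copy of \<open>y\<close> followed by a copy
    of \<open>concat Ys\<close>. The latter will always carry the same \<open>concat bs\<close>, so
    \<open>s\<close> below merges it with \<open>concat Ys\<close>.\<close>
  define Zs where "Zs = map (take ?n) zs"
  have Zs: "length Zs = d'" "\<And>z. z \<in> set Zs \<Longrightarrow> length z = ?n" "set (concat Zs) \<subseteq> set (concat zs)"
    using zs by (auto simp: Zs_def dest: in_set_takeD)
  have distZs: "distinct (concat Zs)"
    unfolding Zs_def using zs(3) by (intro distinct_concat_map_sub) (auto dest: in_set_takeD)
  have dist2: "distinct (y @ concat (Ys @ Zs))"
    using zs(3) Zs(3) distZs
    by (simp only: concat_append distinct_append set_append) blast
  obtain s where s:
    "map s ?U2 = (y @ concat Ys) @ concat (map (\<lambda>z. take ?n z @ concat Ys) zs)"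
    "\<And>u. u \<in> set ?U2 \<Longrightarrow> s (s u) = s u"
    by (rule ex_identifying_map[OF zs(3), of "\<lambda>z. take ?n z @ concat Ys"])
      (auto simp: zs(2) nth_append simp del: set_concat length_concat)
  \<comment> \<open>Indices are natural numbers, so the pair of \<open>i\<close> (choice for the
    head) and \<open>j\<close> (choice for the tail) is coded by \<open>prod_encode\<close>.\<close>
  define H where "H k \<phi> = (case prod_decode k of (i, j) \<Rightarrow> identify s ?U2 (G j (\<psi> i \<phi>)))"
    for k \<phi>
  have H: "fm_of L (H k \<phi>) \<and> fvars (H k \<phi>) \<subseteq> set y \<union> set (concat (Ys @ Zs))"
    if "k \<in> prod_encode ` (I \<times> J)" "\<phi> \<in> \<Delta>" for k \<phi>
  proof -
    obtain i j where ij: "k = prod_encode (i, j)" "i \<in> I" "j \<in> J" using \<open>k \<in> _\<close> by auto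
    have "fvars (H k \<phi>) \<subseteq> s ` set ?U2"
      using fvars_identify[of s ?U2 "G j (\<psi> i \<phi>)"] G[OF ij(3,2) \<open>\<phi> \<in> \<Delta>\<close>] ij(1)
      by (auto simp: H_def)
    also have "\<dots> = set (map s ?U2)" by (simp only: set_map)
    also have "\<dots> \<subseteq> set y \<union> set (concat (Ys @ Zs))" unfolding s(1) by (auto simp: Zs_def)
    finally show ?thesis
      using G[OF ij(3,2) \<open>\<phi> \<in> \<Delta>\<close>] ij(1) by (simp add: H_def fm_of_identify)
  qed
  \<comment> \<open>Under \<open>r\<close> each parameter block reads the common \<open>a\<close>
    first and then its own tuple from \<open>bs\<close>.\<close>
  have step1: "holds M (\<psi> i \<phi>) (x @ y @ concat Ys) (a @ b @ concat bs) =
      holds M (F i \<phi>) ?U1 ((a @ b) @ concat (map ((@) a) bs))"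
    if "i \<in> I" "\<phi> \<in> \<Delta>" "a \<in> tuples (univ M) ?m" "b \<in> tuples (univ M) ?n"
      "length bs = d" "set bs \<subseteq> tuples (univ M) ?n" for i \<phi> a b bs
    unfolding \<psi>_def
  proof (rule holds_identify[OF ys(3) _ r(2)])
    show "fvars (F i \<phi>) \<subseteq> set ?U1" using F that by blast
    let ?e = "assign (x @ y @ concat Ys) (a @ b @ concat bs)"
    have lbs: "\<And>b. b \<in> set bs \<Longrightarrow> length b = ?n" using that(6) by (auto simp: tuples_def)
    have "length (concat bs) = length (concat Ys)"
      using length_concat_uniform[of bs ?n] length_concat_uniform[of Ys ?n] lbs Ys that(5) by simp
    then have "map ?e (x @ y @ concat Ys) = a @ b @ concat bs"
      using that(3,4) by (intro map_assign[OF dist1]) (auto simp: tuples_def)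
    then have e: "map ?e x = a" "map ?e y = b" "map ?e (concat Ys) = concat bs"
      using that(3,4) by (auto simp: tuples_def)
    have "map (map ?e) Ys = bs"
      by (rule map_map_eq_if_concat[OF e(3)]) (use Ys lbs that(5) in auto)
    moreover have "map ((@) a) (map (map ?e) Ys) = map (\<lambda>z. a @ map ?e (drop ?m z)) ys"
      by (simp add: Ys_def)
    ultimately have "map ((@) a) bs = map (\<lambda>z. a @ map ?e (drop ?m z)) ys"
      by (simp only:)
    then show "map ?e (map r ?U1) = (a @ b) @ concat (map ((@) a) bs)"
      unfolding r(1) by (simp add: e map_concat comp_def)
    show "set ((a @ b) @ concat (map ((@) a) bs)) \<subseteq> univ M"
      using that(3,4,6) by (auto simp: tuples_def)
  qed
  \<comment> \<open>Under \<open>s\<close> each block of \<open>zs\<close> reads its own tuple from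
    \<open>cs\<close> and then the common \<open>concat bs\<close>.\<close>
  have step2: "holds M (H (prod_encode (i, j)) \<phi>) (y @ concat (Ys @ Zs)) (b @ concat (bs @ cs)) =
      holds M (G j (\<psi> i \<phi>)) ?U2 ((b @ concat bs) @ concat (map (\<lambda>c. c @ concat bs) cs))"
    if "i \<in> I" "j \<in> J" "\<phi> \<in> \<Delta>" "b \<in> tuples (univ M) ?n"
      "length bs = d" "set bs \<subseteq> tuples (univ M) ?n"
      "length cs = d'" "set cs \<subseteq> tuples (univ M) ?n" for i j \<phi> b bs cs
    unfolding H_def prod_encode_inverse prod.case
  proof (rule holds_identify[OF zs(3) _ s(2)])
    show "fvars (G j (\<psi> i \<phi>)) \<subseteq> set ?U2" using G that by blast
    let ?e = "assign (y @ concat (Ys @ Zs)) (b @ concat (bs @ cs))"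
    have lbs: "\<And>b. b \<in> set bs \<Longrightarrow> length b = ?n" and lcs: "\<And>c. c \<in> set cs \<Longrightarrow> length c = ?n"
      using that(6,8) by (auto simp: tuples_def)
    have len: "length (concat bs) = length (concat Ys)" "length (concat cs) = length (concat Zs)"
      using length_concat_uniform[of bs ?n] length_concat_uniform[of Ys ?n]
        length_concat_uniform[of cs ?n] length_concat_uniform[of Zs ?n] lbs lcs Ys Zs that(5,7)
      by simp_all
    then have "map ?e (y @ concat (Ys @ Zs)) = b @ concat (bs @ cs)"
      using that(4) by (intro map_assign[OF dist2]) (auto simp: tuples_def)
    then have e: "map ?e y = b" "map ?e (concat Ys) = concat bs" "map ?e (concat Zs) = concat cs"
      using that(4) len by (auto simp: tuples_def simp del: length_concat)
    have "map (map ?e) Zs = cs"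
      by (rule map_map_eq_if_concat[OF e(3)]) (use Zs lcs that(7) in auto)
    moreover have "map (\<lambda>c. c @ concat bs) (map (map ?e) Zs) =
        map (\<lambda>z. map ?e (take ?n z) @ concat bs) zs"
      by (simp add: Zs_def)
    ultimately have "map (\<lambda>c. c @ concat bs) cs = map (\<lambda>z. map ?e (take ?n z) @ concat bs) zs"
      by (simp only:)
    moreover have "map ?e (map s ?U2) =
        (b @ concat bs) @ concat (map (\<lambda>z. map ?e (take ?n z) @ map ?e (concat Ys)) zs)"
      unfolding s(1) by (simp only: map_append e map_concat[of _ "map _ zs"] map_map comp_def)
    ultimately show "map ?e (map s ?U2) =
        (b @ concat bs) @ concat (map (\<lambda>c. c @ concat bs) cs)"
      by (simp only: e)
    show "set ((b @ concat bs) @ concat (map (\<lambda>c. c @ concat bs) cs)) \<subseteq> univ M"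
      using that(4,6,8) by (auto simp: tuples_def)
  qed
  have "\<exists>bs k. length bs = d + d' \<and> set bs \<subseteq> B \<and> k \<in> prod_encode ` (I \<times> J) \<and>
      (\<forall>\<phi>\<in>\<Delta>. \<forall>b\<in>B. (\<phi>, b) \<in> q \<longleftrightarrow>
         holds M (H k \<phi>) (y @ concat (Ys @ Zs)) (b @ concat bs))"
    if B: "finite B" "B \<noteq> {}" "B \<subseteq> tuples (univ M) ?n" and q: "q \<in> types M \<Delta> (v # x) y B" for B q
  proof -
    obtain a0 a where a: "a0 \<in> univ M" "a \<in> tuples (univ M) ?m"
      "q = tp M \<Delta> (v # x) y (a0 # a) B"
      using q by (auto simp: types_def tuples_def length_Suc_conv)
    \<comment> \<open>The type of \<open>a0\<close> is taken over all \<open>a @ b\<close> with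
      \<open>b\<close> in \<open>B\<close>; its parameters then have the form \<open>a @ b\<close>
      too, and stripping \<open>a\<close> yields \<open>bs\<close> in \<open>B\<close>.\<close>
    have "(@) a ` B \<subseteq> tuples (univ M) (length (x @ y))"
      using B(3) a(2) by (fastforce simp: tuples_def)
    then obtain bs' i where 1: "length bs' = d" "set bs' \<subseteq> (@) a ` B" "i \<in> I"
      "\<And>\<phi> b. \<phi> \<in> \<Delta> \<Longrightarrow> b \<in> (@) a ` B \<Longrightarrow> holds M \<phi> ([v] @ (x @ y)) ([a0] @ b) \<longleftrightarrow>
         holds M (F i \<phi>) ((x @ y) @ concat ys) (b @ concat bs')"
      by (rule uniform_def_realize[OF u1, of "(@) a ` B" "[a0]", rotated 2])
        (use B a in \<open>simp_all add: tuples_def\<close>)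
    obtain bs where bs: "bs' = map ((@) a) bs" "set bs \<subseteq> B"
      using list_over_image[OF 1(2)] .
    have lbs: "length bs = d" using 1(1) bs(1) by simp
    have tbs: "length b = ?n" "set b \<subseteq> univ M" if "b \<in> set bs" for b
      using that bs(2) B(3) by (auto simp: tuples_def)
    then have "set (concat bs) \<subseteq> univ M" by auto
    moreover have "length (concat bs) = length (concat Ys)"
      using length_concat_uniform[of bs ?n] length_concat_uniform[of Ys ?n] Ys lbs tbs(1) by simp
    \<comment> \<open>Now \<open>bs\<close> is fixed, and the tail \<open>a\<close> has a type over
      the finite set of all \<open>b @ concat bs\<close>; its parameters again end in
      \<open>concat bs\<close>.\<close>
    ultimately have "(\<lambda>b. b @ concat bs) ` B \<subseteq> tuples (univ M) (length (y @ concat Ys))"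
      using B(3) by (fastforce simp: tuples_def simp del: length_concat set_concat)
    then obtain cs' j where 2: "length cs' = d'" "set cs' \<subseteq> (\<lambda>b. b @ concat bs) ` B" "j \<in> J"
      "\<And>\<psi> b. \<psi> \<in> ?\<Delta>' \<Longrightarrow> b \<in> (\<lambda>b. b @ concat bs) ` B \<Longrightarrow>
         holds M \<psi> (x @ (y @ concat Ys)) (a @ b) \<longleftrightarrow>
         holds M (G j \<psi>) ((y @ concat Ys) @ concat zs) (b @ concat cs')"
      by (rule uniform_def_realize[OF u2, of "(\<lambda>b. b @ concat bs) ` B" a, rotated 2])
        (use B a in simp_all)
    obtain cs where cs: "cs' = map (\<lambda>b. b @ concat bs) cs" "set cs \<subseteq> B"
      using list_over_image[OF 2(2)] .
    have lcs: "length cs = d'" using 2(1) cs(1) by simp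
    have "(\<phi>, b) \<in> q \<longleftrightarrow>
        holds M (H (prod_encode (i, j)) \<phi>) (y @ concat (Ys @ Zs)) (b @ concat (bs @ cs))"
      if "\<phi> \<in> \<Delta>" "b \<in> B" for \<phi> b
    proof -
      have b: "b \<in> tuples (univ M) ?n" "set bs \<subseteq> tuples (univ M) ?n" "set cs \<subseteq> tuples (univ M) ?n"
        using that B(3) bs(2) cs(2) by auto
      have "(\<phi>, b) \<in> q \<longleftrightarrow> holds M \<phi> ([v] @ (x @ y)) ([a0] @ (a @ b))"
        using that by (simp add: a(3) tp_iff)
      also have "\<dots> \<longleftrightarrow> holds M (F i \<phi>) ?U1 ((a @ b) @ concat (map ((@) a) bs))"
        using 1(4)[OF that(1), of "a @ b"] that(2) bs(1) by blast
      also have "\<dots> \<longleftrightarrow> holds M (\<psi> i \<phi>) (x @ (y @ concat Ys)) (a @ (b @ concat bs))"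
        using step1[OF 1(3) that(1) a(2) b(1) lbs b(2)] by simp
      also have "\<dots> \<longleftrightarrow>
          holds M (G j (\<psi> i \<phi>)) ?U2 ((b @ concat bs) @ concat (map (\<lambda>c. c @ concat bs) cs))"
        unfolding cs(1)[symmetric] by (rule 2(4)) (use that 1(3) in auto)
      also have "\<dots> \<longleftrightarrow>
          holds M (H (prod_encode (i, j)) \<phi>) (y @ concat (Ys @ Zs)) (b @ concat (bs @ cs))"
        using step2[OF 1(3) 2(3) that(1) b(1) lbs b(2) lcs b(3)] by simp
      finally show ?thesis .
    qed
    \<comment> \<open>The \<open>d\<close> parameters \<open>bs\<close> come from the head and the
      \<open>d'\<close> parameters \<open>cs\<close> from the tail.\<close>
    then show ?thesis
      using lbs lcs bs(2) cs(2) 1(3) 2(3)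
      by (intro exI[of _ "bs @ cs"] exI[of _ "prod_encode (i, j)"]) auto
  qed
  moreover have "\<forall>z\<in>set (Ys @ Zs). length z = ?n" using Ys(2) Zs(2) by auto
  ultimately have "uniform_def L M \<Delta> (v # x) y (d + d') (Ys @ Zs) (prod_encode ` (I \<times> J)) H"
    unfolding uniform_def_def using Ys(1) Zs(1) dist2 ys(4) zs(4) H by auto
  then show ?thesis unfolding has_uniform_def_def by blast
qed

section \<open>Induction on the length of \<open>x\<close>\<close>

theorem theorem5p7:
  fixes L :: "('f, 'r) language"
    and M :: "('a, 'f, 'r) struct"
    and \<Delta> :: "('f, 'r) fm set"
    and x y :: "nat list"
    and d :: nat
  assumes "is_structure L M"
    and "VC_property L M d"
    and "finite \<Delta>" and "\<Delta> \<noteq> {}"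
    and "partitioned_fms L \<Delta> x y"
  shows "has_uniform_def L M \<Delta> x y (d * length x)"
  using assms(3-5)
proof (induction x arbitrary: \<Delta> y)
  case Nil
  then show ?case by (simp add: has_uniform_def_Nil)
next
  case (Cons v x)
  \<comment> \<open>Repartitioning moves the tail \<open>x\<close> to the parameter side, leaving
    one object variable, so that the VC property applies.\<close>
  have "partitioned_fms L \<Delta> [v] (x @ y)"
    using Cons.prems(3) by (auto simp: partitioned_fms_def)
  then have "has_uniform_def L M \<Delta> [v] (x @ y) d"
    using assms(2) Cons.prems unfolding VC_property_def by simp
  from has_uniform_def_Cons[OF assms(1) Cons.prems(1,2) this Cons.IH] show ?case by simp
qed

end
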